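(* Let $N:\mathbb{R}\to\mathbb{R}_{+}$ be a measurable function. If $\mathrm{Lip}(N)\le \frac12$, then for all $f\in BV(\mathbb{R})$, $$\mathcal{V}(M^1_N f)\le \mathcal{V}(f).$$ Moreover, the result is sharp, in the sense that there are non-constant functions $f \in BV(\mathbb{R})$ such that $\mathcal{V}(f) = \mathcal{V}(M^1_N f)$.
   Context: $\mathbb{R}_+=(0,\infty)$. For $N:\mathbb{R}\to\mathbb{R}_+$ and $f:\mathbb{R}\to\mathbb{R}$ locally integrable, the $N$-truncated uncentered maximal function is $$M^1_N f(x) = \sup_{(y,t):\ t>0,\ |x-y|\le t\le N(x)} \frac{1}{2t}\int_{y-t}^{y+t} |f(s)|\,ds .$$ The Lipschitz constant is $\mathrm{Lip}(N) = \sup_{x\ne y} \frac{|N(x)-N(y)|}{|x-y|}$. The total variation of $g:\mathbb{R}\to\mathbb{R}$ is $\mathcal{V}(g) = \sup \sum_{i=1}^{n-1} |g(x_{i+1})-g(x_i)|$ over all finite sequences $x_1<\dots<x_n$. $BV(\mathbb{R})$ is the space of functions $f:\mathbb{R}\to\mathbb{R}$ that agree almost everywhere with some $g$ such that $\mathcal{V}(g)<\infty$. Functions in $BV(\mathbb{R})$ are taken to be normalized: $f(x) = \limsup_{y\to x,\, y\neq x} g(y)$ for every $x$, where $g=f$ a.e. and $\mathcal{V}(g)<\infty$; $\mathcal{V}(f)$ refers to this representative. *)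

theory Defs
  imports "HOL-Analysis.Analysis"
begin

text \<open>The supremum may be infinite, hence values in \<^typ>\<open>ereal\<close>.\<close>

definition Lip :: "(real \<Rightarrow> real) \<Rightarrow> ereal" where
  "Lip N = (SUP (x, y)\<in>{(x, y). x \<noteq> y}. ereal (\<bar>N x - N y\<bar> / \<bar>x - y\<bar>))"

definition total_variation :: "(real \<Rightarrow> real) \<Rightarrow> ereal" where
  "total_variation g =
    (SUP (n, x)\<in>{(n, x :: nat \<Rightarrow> real). strict_mono_on {1..n} x}.
       ereal (\<Sum>i=1..<n. \<bar>g (x (Suc i)) - g (x i)\<bar>))"

text \<open>
  For \<^term>\<open>N x > 0\<close> the index set is nonempty. The real supremum is the true supremum as soon as
  the averages are bounded; lemma \<open>maximal_averages_bdd_above\<close> below shows that this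
  holds whenever f has bounded variation up to a null set.
\<close>

definition maximal :: "(real \<Rightarrow> real) \<Rightarrow> (real \<Rightarrow> real) \<Rightarrow> real \<Rightarrow> real" where
  "maximal N f x =
    (SUP (y, t)\<in>{(y, t). 0 < t \<and> \<bar>x - y\<bar> \<le> t \<and> t \<le> N x}.
       1 / (2 * t) * (LINT s:{y - t..y + t}|lebesgue. \<bar>f s\<bar>))"

definition BV_version :: "(real \<Rightarrow> real) \<Rightarrow> (real \<Rightarrow> real) \<Rightarrow> bool" where
  "BV_version f g \<longleftrightarrow> (AE x in lebesgue. f x = g x) \<and> total_variation g < \<infinity>"

definition BV :: "(real \<Rightarrow> real) set" where
  "BV = {f. \<exists>g. BV_version f g}"

text \<open>
  The filter \<^term>\<open>at x\<close> excludes the point x itself. The limit superior does not depend on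
  the choice of g: all versions of f have the same one-sided limits.
\<close>

definition normalized :: "(real \<Rightarrow> real) \<Rightarrow> bool" where
  "normalized f \<longleftrightarrow>
    (\<exists>g. BV_version f g \<and> (\<forall>x. ereal (f x) = Limsup (at x) (\<lambda>y. ereal (g y))))"

lemma total_variation_ge_abs_diff: "ereal \<bar>g b - g a\<bar> \<le> total_variation g"
proof -
  have *: "ereal \<bar>g d - g c\<bar> \<le> total_variation g" if "c < d" for c d
  proof -
    define x :: "nat \<Rightarrow> real" where "x i = (if i \<le> 1 then c else d)" for i
    have "strict_mono_on {1..2} x"
      using that by (auto simp: strict_mono_on_def x_def)
    then have "(2, x) \<in> {(n, x :: nat \<Rightarrow> real). strict_mono_on {1..n} x}" by simp
    from SUP_upper[OF this, of "\<lambda>(n, x). ereal (\<Sum>i=1..<n. \<bar>g (x (Suc i)) - g (x i)\<bar>)"]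
    show ?thesis by (simp add: total_variation_def x_def numeral_2_eq_2)
  qed
  consider "a < b" | "b < a" | "a = b" by linarith
  then show ?thesis
  proof cases
    case 3
    then show ?thesis using *[of 0 1] by (auto intro: order_trans[rotated])
  qed (use *[of a b] *[of b a] in \<open>auto simp: abs_minus_commute\<close>)
qed

lemma maximal_averages_bdd_above:
  assumes "f \<in> BV"
  shows "bdd_above ((\<lambda>(y, t). 1 / (2 * t) * (LINT s:{y - t..y + t}|lebesgue. \<bar>f s\<bar>)) `
           {(y, t). 0 < t \<and> \<bar>x - y\<bar> \<le> t \<and> t \<le> N x})"
proof -
  obtain g where fg: "AE x in lebesgue. f x = g x" and fin: "total_variation g < \<infinity>"
    using assms by (auto simp: BV_def BV_version_def)
  have "0 \<le> total_variation g"
    using total_variation_ge_abs_diff[of g 0 0] by (simp add: zero_ereal_def)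
  with fin obtain V where V: "total_variation g = ereal V"
    by (cases "total_variation g") auto
  define B where "B = \<bar>g 0\<bar> + V"
  have B: "\<bar>g s\<bar> \<le> B" for s
    using total_variation_ge_abs_diff[of g s 0] V by (simp add: B_def)
  have "1 / (2 * t) * (LINT s:{y - t..y + t}|lebesgue. \<bar>f s\<bar>) \<le> B" if "0 < t" for y t
  proof -
    have "(LINT s:{y - t..y + t}|lebesgue. \<bar>f s\<bar>) \<le> (LINT s:{y - t..y + t}|lebesgue. B)"
      unfolding set_lebesgue_integral_def
    proof (rule integral_mono_AE')
      show "integrable lebesgue (\<lambda>s. indicator {y - t..y + t} s *\<^sub>R B)"
        by (intro integrable_scaleR_left integrable_real_indicator) (auto simp: less_top[symmetric] emeasure_lborel_Icc_eq)
      show "AE s in lebesgue. indicator {y - t..y + t} s *\<^sub>R \<bar>f s\<bar> \<le> indicator {y - t..y + t} s *\<^sub>R B"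
        using fg by eventually_elim (use B in \<open>auto simp: indicator_def\<close>)
      show "AE s in lebesgue. 0 \<le> indicator {y - t..y + t} s *\<^sub>R B"
        using order_trans[OF abs_ge_zero B] by (auto simp: indicator_def)
    qed
    also have "\<dots> = 2 * t * B"
      using that by (simp add: set_lebesgue_integral_def)
    finally show ?thesis using that by (simp add: field_simps)
  qed
  then show ?thesis by (intro bdd_aboveI[of _ B]) auto
qed

end

theory Submission
  imports Defs
begin

text \<open>
  The maximal function F dominates |f| pointwise, so it suffices to see that between two points where
  F is below a value A < F(x) there is a point where |f| is at least A. Let I be an interval
  admissible at x on which |f| has average more than A. If |f| < A between the two points, then
  removing this stretch from I leaves a piece on which the average still exceeds A. Such a piece
  has one of the two points as an endpoint, and since N changes by at most half the distance, the
  removed length makes the piece admissible there, so that F exceeds A at that point.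
  Hence along any sequence of alternating local extrema of F one can keep the minima and replace
  the maxima by points where |f| is almost as large, without changing their order.
\<close>

section \<open>Variation along increasing lists\<close>

text \<open>Lists allow points to be inserted, dropped and replaced by structural induction, without
  reindexing sums.\<close>

fun list_variation :: "(real \<Rightarrow> real) \<Rightarrow> real list \<Rightarrow> real" where
  "list_variation g (x # y # xs) = \<bar>g y - g x\<bar> + list_variation g (y # xs)"
| "list_variation g _ = 0"

lemma list_variation_map_upt:
  "list_variation g (map x [m..<Suc n]) = (\<Sum>i=m..<n. \<bar>g (x (Suc i)) - g (x i)\<bar>)"
proof (induction "n - m" arbitrary: m)
  case 0
  then show ?case by (cases "m = n") auto
next
  case (Suc k)
  then have "m < n" by simp
  then have "[m..<Suc n] = m # Suc m # [Suc (Suc m)..<Suc n]" "[Suc m..<Suc n] = Suc m # [Suc (Suc m)..<Suc n]"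
    by (simp_all add: upt_conv_Cons del: upt_Suc)
  with Suc(1)[of "Suc m"] Suc(2) \<open>m < n\<close> show ?case
    by (simp add: sum.atLeast_Suc_lessThan del: upt_Suc)
qed

lemma list_variation_le_total_variation:
  assumes "sorted_wrt (<) xs"
  shows "ereal (list_variation g xs) \<le> total_variation g"
proof -
  \<comment> \<open>Points are numbered from 1 in \<open>total_variation\<close> but from 0 in a
    list.\<close>
  define x where "x i = xs ! (i - 1)" for i
  have "map x [1..<Suc (length xs)] = map (x \<circ> Suc) [0..<length xs]"
    by (simp add: map_Suc_upt[symmetric] del: upt_Suc)
  also have "\<dots> = xs"
    by (simp add: x_def comp_def map_nth)
  finally have upt: "map x [1..<Suc (length xs)] = xs" .
  have *: "list_variation g xs = (\<Sum>i=1..<length xs. \<bar>g (x (Suc i)) - g (x i)\<bar>)"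
    using list_variation_map_upt[of g x 1 "length xs"] unfolding upt .
  have "strict_mono_on {1..length xs} x"
    using assms by (auto simp: strict_mono_on_def x_def sorted_wrt_iff_nth_less)
  then have "(length xs, x) \<in> {(n, x :: nat \<Rightarrow> real). strict_mono_on {1..n} x}" by simp
  from SUP_upper[OF this, of "\<lambda>(n, x). ereal (\<Sum>i=1..<n. \<bar>g (x (Suc i)) - g (x i)\<bar>)"]
  show ?thesis by (simp add: total_variation_def *)
qed

lemma total_variation_leI:
  assumes "\<And>xs. sorted_wrt (<) xs \<Longrightarrow> ereal (list_variation g xs) \<le> V"
  shows "total_variation g \<le> V"
  unfolding total_variation_def
proof (rule SUP_least, clarify)
  fix n and x :: "nat \<Rightarrow> real"
  assume "strict_mono_on {1..n} x"
  then have "sorted_wrt (<) (map x [1..<Suc n])"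
    by (auto simp: sorted_wrt_iff_nth_less strict_mono_on_def simp del: upt_Suc)
  from assms[OF this] show "ereal (\<Sum>i=1..<n. \<bar>g (x (Suc i)) - g (x i)\<bar>) \<le> V"
    by (simp only: list_variation_map_upt)
qed

lemma total_variation_abs_le: "total_variation (\<lambda>x. \<bar>f x\<bar>) \<le> total_variation f"
proof (rule total_variation_leI)
  fix xs :: "real list"
  assume "sorted_wrt (<) xs"
  have "list_variation (\<lambda>x. \<bar>f x\<bar>) xs \<le> list_variation f xs"
    by (induction f xs rule: list_variation.induct) auto
  then show "ereal (list_variation (\<lambda>x. \<bar>f x\<bar>) xs) \<le> total_variation f"
    using list_variation_le_total_variation[OF \<open>sorted_wrt (<) xs\<close>, of f]
    by (meson ereal_less_eq(3) order_trans)
qed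

text \<open>The increments telescope. The induction uses the sharper bound \<open>b - g x\<close>
  for a list with head \<open>x\<close>.\<close>

lemma total_variation_mono:
  assumes "mono g" "\<And>x. a \<le> g x" "\<And>x. g x \<le> b"
  shows "total_variation g \<le> ereal (b - a)"
proof (rule total_variation_leI)
  have "list_variation g (x # xs) \<le> b - g x" if "sorted_wrt (<) (x # xs)" for x xs
    using that
  proof (induction xs arbitrary: x)
    case Nil
    then show ?case using assms by simp
  next
    case (Cons y xs)
    then have "g x \<le> g y" using \<open>mono g\<close> by (auto simp: mono_def)
    with Cons show ?case by force
  qed
  note * = this
  have "0 \<le> b - a" using assms(2,3)[of 0] by linarith
  fix xs :: "real list"
  assume "sorted_wrt (<) xs"
  then show "ereal (list_variation g xs) \<le> ereal (b - a)"
    using *[of "hd xs" "tl xs"] assms(2)[of "hd xs"] \<open>0 \<le> b - a\<close> by (cases xs) auto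
qed

section \<open>Functions of bounded variation\<close>

lemma total_variation_real:
  assumes "total_variation g < \<infinity>"
  obtains V where "total_variation g = ereal V"
  using assms total_variation_ge_abs_diff[of g 0 0]
  by (cases "total_variation g") (auto simp: zero_ereal_def)

lemma bounded_of_total_variation:
  assumes "total_variation g < \<infinity>"
  obtains B where "\<And>x. \<bar>g x\<bar> \<le> B"
proof -
  obtain V where V: "total_variation g = ereal V"
    using assms by (rule total_variation_real)
  have "\<bar>g x\<bar> \<le> \<bar>g 0\<bar> + V" for x
    using total_variation_ge_abs_diff[of g x 0] V by simp
  then show thesis by (rule that)
qed

text \<open>Let \<open>v x\<close> be the variation of \<open>g\<close> on the half-line to the
  right of \<open>x\<close>. Moving from \<open>x\<close> to a larger \<open>y\<close> loses at
  least \<open>|g y - g x|\<close> of it, so \<open>- v\<close> and \<open>- v - g\<close> are both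
  nondecreasing; their difference is \<open>g\<close>.\<close>

lemma Jordan_decomposition:
  assumes "total_variation g < \<infinity>"
  obtains v w where "mono v" "mono w" "\<And>x. g x = v x - w x"
proof -
  obtain V where V: "total_variation g = ereal V"
    using assms by (rule total_variation_real)
  \<comment> \<open>v x is the variation on the right half-line, so that lists are extended at their head.\<close>
  define S where "S x = {xs. sorted_wrt (<) xs \<and> (\<forall>y\<in>set xs. x \<le> y)}" for x :: real
  define v where "v x = (SUP xs\<in>S x. list_variation g xs)" for x
  have bdd: "bdd_above (list_variation g ` S x)" for x
    using list_variation_le_total_variation[of _ g] V by (intro bdd_aboveI[of _ V]) (auto simp: S_def)
  have step: "v y + \<bar>g y - g x\<bar> \<le> v x" if "x < y" for x y
  proof -
    have "v y \<le> v x - \<bar>g y - g x\<bar>"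
      unfolding v_def[of y]
    proof (rule cSUP_least)
      show "S y \<noteq> {}" by (auto simp: S_def intro: exI[of _ "[]"])
      fix xs assume xs: "xs \<in> S y"
      \<comment> \<open>\<open>y\<close> is prepended unless it is already the head, so that
        \<open>x # ys\<close> contains the step from \<open>x\<close> to \<open>y\<close> and stays
        strictly increasing.\<close>
      define ys where "ys = (if xs \<noteq> [] \<and> hd xs = y then xs else y # xs)"
      have "\<forall>z\<in>set ys. y \<le> z"
        using xs by (auto simp: S_def ys_def)
      moreover have "sorted_wrt (<) ys"
        using xs by (cases xs; force simp: S_def ys_def)
      ultimately have "x # ys \<in> S x"
        using \<open>x < y\<close> by (force simp: S_def)
      then have "list_variation g (x # ys) \<le> v x"
        unfolding v_def by (rule cSUP_upper[OF _ bdd])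
      moreover have "list_variation g xs + \<bar>g y - g x\<bar> \<le> list_variation g (x # ys)"
        by (cases xs) (auto simp: ys_def)
      ultimately show "list_variation g xs \<le> v x - \<bar>g y - g x\<bar>" by simp
    qed
    then show ?thesis by simp
  qed
  show thesis
  proof
    show "mono (\<lambda>x. - v x)" "mono (\<lambda>x. - v x - g x)"
      using step by (force intro!: monoI simp: order_le_less)+
  qed auto
qed

section \<open>One-sided limits\<close>

lemma mono_tendsto_at_right:
  fixes v :: "real \<Rightarrow> real"
  assumes "mono v"
  shows "(v \<longlongrightarrow> (INF y\<in>{x<..}. v y)) (at_right x)"
proof (rule order_tendstoI)
  have bdd: "bdd_below (v ` {x<..})"
    using \<open>mono v\<close> by (intro bdd_belowI[of _ "v x"]) (auto simp: mono_def)
  {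
    fix a assume a: "a < (INF y\<in>{x<..}. v y)"
    have "a < v y" if "x < y" for y
      using a cINF_lower[OF bdd, of y] that by simp
    then show "\<forall>\<^sub>F y in at_right x. a < v y"
      by (simp add: eventually_at_right_less eventually_at_filter)
  next
    fix a assume "(INF y\<in>{x<..}. v y) < a"
    then obtain b where b: "x < b" "v b < a"
      using cINF_less_iff[of "{x<..}" v a] bdd by auto
    have "v y < a" if "y < b" for y
      using \<open>mono v\<close> b that by (meson le_less_trans less_imp_le monoD)
    with b show "\<forall>\<^sub>F y in at_right x. v y < a"
      by (auto simp: eventually_at_right_field)
  }
qed

text \<open>The limit is the supremum of \<open>v\<close> to the left of \<open>x\<close>, written
  as a negated infimum because reflection reduces the claim to limits from the right.\<close>

lemma mono_tendsto_at_left: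
  fixes v :: "real \<Rightarrow> real"
  assumes "mono v"
  shows "(v \<longlongrightarrow> - (INF y\<in>{-x<..}. - v (- y))) (at_left x)"
proof -
  have "mono (\<lambda>y. - v (- y))" using assms by (auto simp: mono_def)
  from tendsto_minus[OF mono_tendsto_at_right[OF this, of "- x"]]
  show ?thesis
    by (simp add: filterlim_at_left_to_right)
qed

lemma one_sided_limits:
  assumes "total_variation g < \<infinity>"
  obtains l r where "(g \<longlongrightarrow> l) (at_left x)" "(g \<longlongrightarrow> r) (at_right x)"
proof -
  obtain v w where vw: "mono v" "mono w" and g: "\<And>x. g x = v x - w x"
    using assms by (rule Jordan_decomposition) blast
  show thesis
    by (rule that; unfold g)
      (rule tendsto_diff mono_tendsto_at_left mono_tendsto_at_right vw)+
qed

section \<open>Measurability and integrability\<close>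

lemma borel_measurable_of_total_variation:
  assumes "total_variation g < \<infinity>"
  shows "g \<in> borel_measurable borel"
proof -
  obtain v w where vw: "mono v" "mono w" and g: "\<And>x. g x = v x - w x"
    using assms by (rule Jordan_decomposition) blast
  then have *: "g = (\<lambda>x. v x - w x)" by auto
  show ?thesis
    unfolding * by (intro borel_measurable_diff borel_measurable_mono vw)
qed

lemma AE_lebesgue_obtain_negligible:
  assumes "AE x in lebesgue. P x"
  obtains S where "negligible S" "\<And>x. x \<notin> S \<Longrightarrow> P x"
proof
  show "negligible {x. \<not> P x}"
    using assms by (simp add: completion.AE_iff_null_sets negligible_iff_null_sets)
qed auto

text \<open>A version of bounded variation is bounded and Borel, and integrability survives a change
  on a null set. Averages can then be treated as gauge integrals, which split over adjacent
  intervals.\<close>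

lemma BV_abs_set_integrable:
  assumes "f \<in> BV"
  shows "set_integrable lebesgue {a..b} (\<lambda>s. \<bar>f s\<bar>)"
proof -
  obtain g where "BV_version f g" using assms by (auto simp: BV_def)
  then have fg: "AE x in lebesgue. f x = g x" and fin: "total_variation g < \<infinity>"
    by (auto simp: BV_version_def)
  obtain B where B: "\<And>x. \<bar>g x\<bar> \<le> B" using bounded_of_total_variation[OF fin] by blast
  have "g \<in> borel_measurable lebesgue"
    using borel_measurable_of_total_variation[OF fin] by (simp add: measurable_completion)
  then have "(\<lambda>s. \<bar>g s\<bar>) \<in> borel_measurable (lebesgue_on {a..b})"
    by (intro borel_measurable_abs measurable_restrict_space1)
  then have *: "(\<lambda>s. \<bar>g s\<bar>) absolutely_integrable_on {a..b}"
    by (rule measurable_bounded_by_integrable_imp_absolutely_integrable[where g="\<lambda>_. B"])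
      (use B in auto)
  obtain S where "negligible S" "\<And>x. x \<notin> S \<Longrightarrow> f x = g x"
    using AE_lebesgue_obtain_negligible[OF fg] by blast
  with * show ?thesis
    by (intro absolutely_integrable_spike[OF *]) auto
qed

section \<open>The truncated maximal function\<close>

text \<open>In terms of end points, \<open>(y, t)\<close> is admissible at \<open>x\<close> when the
  interval contains \<open>x\<close> and has positive length at most \<open>2 * N x\<close>.\<close>

lemma maximal_ge:
  assumes "f \<in> BV" "a < b" "a \<le> x" "x \<le> b" "b - a \<le> 2 * N x"
  shows "integral {a..b} (\<lambda>s. \<bar>f s\<bar>) \<le> maximal N f x * (b - a)"
proof -
  define y t where "y = (a + b) / 2" and "t = (b - a) / 2"
  have ab: "a = y - t" "b = y + t" by (auto simp: y_def t_def field_simps)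
  have "0 < t" using assms by (simp add: t_def)
  have "(y, t) \<in> {(y, t). 0 < t \<and> \<bar>x - y\<bar> \<le> t \<and> t \<le> N x}"
    using assms unfolding ab by auto
  from cSUP_upper[OF this maximal_averages_bdd_above[OF assms(1), of x N]]
  have "1 / (2 * t) * (LINT s:{a..b}|lebesgue. \<bar>f s\<bar>) \<le> maximal N f x"
    by (simp add: maximal_def ab)
  then show ?thesis
    using \<open>0 < t\<close> set_lebesgue_integral_eq_integral(2)[OF BV_abs_set_integrable[OF assms(1), of a b]]
    by (simp add: ab field_simps)
qed

text \<open>The supremum need not be attained, but some admissible average exceeds any smaller
  \<open>A\<close>. The pair \<open>(x, N x)\<close> shows that the index set is nonempty.\<close>

lemma less_maximal:
  assumes "f \<in> BV" "0 < N x" "A < maximal N f x"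
  obtains a b where "a < b" "a \<le> x" "x \<le> b" "b - a \<le> 2 * N x"
    "A * (b - a) < integral {a..b} (\<lambda>s. \<bar>f s\<bar>)"
proof -
  have "(x, N x) \<in> {(y, t). 0 < t \<and> \<bar>x - y\<bar> \<le> t \<and> t \<le> N x}" using assms by simp
  then have "{(y, t). 0 < t \<and> \<bar>x - y\<bar> \<le> t \<and> t \<le> N x} \<noteq> {}" by blast
  from less_cSUP_iff[OF this maximal_averages_bdd_above[OF assms(1), of x N]] assms(3)
  obtain y t where t: "0 < t" "\<bar>x - y\<bar> \<le> t" "t \<le> N x"
    and "A < 1 / (2 * t) * (LINT s:{y - t..y + t}|lebesgue. \<bar>f s\<bar>)"
    unfolding maximal_def by auto
  then have "A * (2 * t) < integral {y - t..y + t} (\<lambda>s. \<bar>f s\<bar>)"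
    using set_lebesgue_integral_eq_integral(2)[OF BV_abs_set_integrable[OF assms(1), of "y - t" "y + t"]]
    by (simp add: field_simps)
  with t show thesis by (intro that[of "y - t" "y + t"]) auto
qed

text \<open>On a short interval with end point \<open>x\<close>, on the side of the limit,
  \<open>|g|\<close> is at least \<open>|r| - e\<close>. Cut to length at most
  \<open>2 * N x\<close>, the interval is admissible at \<open>x\<close>, and its average is at
  least \<open>|r| - e\<close>.\<close>

lemma abs_one_sided_limit_le_maximal:
  assumes BV: "f \<in> BV" "0 < N x"
    and fg: "AE x in lebesgue. f x = g x"
    and lim: "(g \<longlongrightarrow> r) (at_left x) \<or> (g \<longlongrightarrow> r) (at_right x)"
  shows "\<bar>r\<bar> \<le> maximal N f x"
proof (rule field_le_epsilon)
  fix e :: real assume "0 < e"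
  obtain a b where ab: "a < b" "a \<le> x" "x \<le> b" "b - a \<le> 2 * N x"
    and le: "\<And>y. a < y \<Longrightarrow> y < b \<Longrightarrow> \<bar>r\<bar> - e \<le> \<bar>g y\<bar>"
  proof (cases "(g \<longlongrightarrow> r) (at_right x)")
    case True
    then have "\<forall>\<^sub>F y in at_right x. \<bar>r\<bar> - e < \<bar>g y\<bar>"
      using \<open>0 < e\<close> by (intro order_tendstoD[OF tendsto_rabs]) auto
    then obtain b where b: "x < b" "\<And>y. x < y \<Longrightarrow> y < b \<Longrightarrow> \<bar>r\<bar> - e < \<bar>g y\<bar>"
      by (auto simp: eventually_at_right_field)
    show thesis
      by (rule that[of x "min b (x + 2 * N x)"]) (use b \<open>0 < N x\<close> in \<open>force+\<close>)
  next
    case False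
    with lim have "\<forall>\<^sub>F y in at_left x. \<bar>r\<bar> - e < \<bar>g y\<bar>"
      using \<open>0 < e\<close> by (intro order_tendstoD[OF tendsto_rabs]) auto
    then obtain a where a: "a < x" "\<And>y. a < y \<Longrightarrow> y < x \<Longrightarrow> \<bar>r\<bar> - e < \<bar>g y\<bar>"
      by (auto simp: eventually_at_left_field)
    show thesis
      by (rule that[of "max a (x - 2 * N x)" x]) (use a \<open>0 < N x\<close> in \<open>force+\<close>)
  qed
  obtain S where S: "negligible S" "\<And>x. x \<notin> S \<Longrightarrow> f x = g x"
    using AE_lebesgue_obtain_negligible[OF fg] by blast
  have int: "(\<lambda>s. \<bar>f s\<bar>) integrable_on {a..b}"
    using BV_abs_set_integrable[OF BV(1)] set_lebesgue_integral_eq_integral(1) by blast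
  \<comment> \<open>Changing \<open>|f|\<close> on a null set turns the almost everywhere bound into
    one at every point of \<open>{a..b}\<close>.\<close>
  define h where "h s = (if s \<in> S \<union> {a, b} then \<bar>r\<bar> - e else \<bar>f s\<bar>)" for s
  have neg: "negligible (S \<union> {a, b})"
    using S(1) by (auto simp: negligible_insert)
  have "h integrable_on {a..b}"
    by (rule integrable_spike[OF int neg]) (simp add: h_def)
  then have le_h: "integral {a..b} (\<lambda>_. \<bar>r\<bar> - e) \<le> integral {a..b} h"
    using le S(2) by (intro integral_le) (auto simp: h_def)
  have "(\<bar>r\<bar> - e) * (b - a) = integral {a..b} (\<lambda>_. \<bar>r\<bar> - e)"
    using \<open>a < b\<close> by simp
  also note le_h
  also have "integral {a..b} h = integral {a..b} (\<lambda>s. \<bar>f s\<bar>)"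
    by (rule integral_spike[OF neg]) (simp add: h_def)
  also note maximal_ge[where N=N, OF BV(1) ab]
  finally have "\<bar>r\<bar> - e \<le> maximal N f x"
    using \<open>a < b\<close> by simp
  then show "\<bar>r\<bar> \<le> maximal N f x + e" by simp
qed

text \<open>A punctured neighbourhood consists of its two sides, which gives the upper bound.
  Conversely, a limit along a filter finer than \<open>at x\<close> cannot exceed the limit
  superior.\<close>

lemma Limsup_at_eq_max_one_sided:
  fixes g :: "real \<Rightarrow> real"
  assumes l: "(g \<longlongrightarrow> l) (at_left x)" and r: "(g \<longlongrightarrow> r) (at_right x)"
  shows "Limsup (at x) (\<lambda>y. ereal (g y)) = ereal (max l r)"
proof (rule antisym)
  have l': "((\<lambda>y. ereal (g y)) \<longlongrightarrow> ereal l) (at_left x)"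
    and r': "((\<lambda>y. ereal (g y)) \<longlongrightarrow> ereal r) (at_right x)"
    using l r by simp_all
  show "Limsup (at x) (\<lambda>y. ereal (g y)) \<le> ereal (max l r)"
    unfolding Limsup_le_iff eventually_at_split
    by (intro allI impI conjI order_tendstoD[OF l'] order_tendstoD[OF r'])
      (auto intro: le_less_trans[rotated])
  have "ereal c \<le> Limsup (at x) (\<lambda>y. ereal (g y))"
    if "((\<lambda>y. ereal (g y)) \<longlongrightarrow> ereal c) F" "F \<noteq> bot" "F \<le> at x" for c F
  proof (rule ccontr)
    assume "\<not> ereal c \<le> Limsup (at x) (\<lambda>y. ereal (g y))"
    then obtain y where y: "Limsup (at x) (\<lambda>y. ereal (g y)) < y" "y < ereal c"
      using dense[of "Limsup (at x) (\<lambda>y. ereal (g y))" "ereal c"] by (auto simp: not_le)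
    have "\<forall>\<^sub>F z in F. ereal (g z) < y"
      using Limsup_lessD[OF y(1)] that(3) by (rule filter_leD[rotated])
    moreover have "\<forall>\<^sub>F z in F. y < ereal (g z)"
      using order_tendstoD(1)[OF that(1) y(2)] .
    ultimately have "\<forall>\<^sub>F z in F. False" by eventually_elim auto
    with that(2) show False by simp
  qed
  from this[OF l'] this[OF r'] show "ereal (max l r) \<le> Limsup (at x) (\<lambda>y. ereal (g y))"
    by (auto simp: max_def at_le)
qed

text \<open>Normalization makes \<open>f x\<close> the larger of the two one-sided limits of a
  version, and each of these is dominated in absolute value.\<close>

lemma abs_le_maximal:
  assumes "f \<in> BV" "normalized f" "0 < N x"
  shows "\<bar>f x\<bar> \<le> maximal N f x"
proof -
  obtain g where fg: "AE x in lebesgue. f x = g x" and fin: "total_variation g < \<infinity>"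
    and f: "\<And>x. ereal (f x) = Limsup (at x) (\<lambda>y. ereal (g y))"
    using assms(2) by (auto simp: normalized_def BV_version_def)
  obtain l r where lr: "(g \<longlongrightarrow> l) (at_left x)" "(g \<longlongrightarrow> r) (at_right x)"
    using one_sided_limits[OF fin] by blast
  have "f x = max l r"
    using f[of x] Limsup_at_eq_max_one_sided[OF lr] by (metis ereal.inject)
  with lr show ?thesis
    using abs_one_sided_limit_le_maximal[where N=N and x=x, OF assms(1,3) fg, of l]
      abs_one_sided_limit_le_maximal[where N=N and x=x, OF assms(1,3) fg, of r] by (auto simp: max_def)
qed

text \<open>An interval \<open>{a..b}\<close> with average above \<open>A\<close> is cut at
  \<open>p\<close> and \<open>q\<close> into at most three pieces, each with integral at most
  \<open>A\<close> times its length if no \<open>z\<close> exists. The alternatives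
  \<open>p < x - 2 * N x\<close> and \<open>x + 2 * N x < q\<close> put a point out of reach, so
  that no cut occurs there.\<close>

lemma maximal_peak:
  assumes BV: "f \<in> BV" and N: "\<And>x. 0 < N x" "\<And>x y. \<bar>N x - N y\<bar> \<le> \<bar>x - y\<bar> / 2"
    and dom: "\<And>x. \<bar>f x\<bar> \<le> maximal N f x"
    and A: "A < maximal N f x"
    and p: "p < x" "maximal N f p < A \<or> p < x - 2 * N x"
    and q: "x < q" "maximal N f q < A \<or> x + 2 * N x < q"
  shows "\<exists>z. p < z \<and> z < q \<and> A \<le> \<bar>f z\<bar>"
proof (rule ccontr)
  assume "\<nexists>z. p < z \<and> z < q \<and> A \<le> \<bar>f z\<bar>"
  then have less: "\<bar>f z\<bar> < A" if "p < z" "z < q" for z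
    using that by (meson not_le)
  obtain a b where ab: "a < b" "a \<le> x" "x \<le> b" "b - a \<le> 2 * N x"
    and avg: "A * (b - a) < integral {a..b} (\<lambda>s. \<bar>f s\<bar>)"
    using less_maximal[OF BV N(1) A] .
  define c d where "c = max a p" and "d = min b q"
  have ord: "a \<le> c" "c \<le> x" "x \<le> d" "d \<le> b"
    using ab p q by (auto simp: c_def d_def)
  have int: "(\<lambda>s. \<bar>f s\<bar>) integrable_on {u..v}" for u v
    using BV_abs_set_integrable[OF BV] set_lebesgue_integral_eq_integral(1) by blast
  \<comment> \<open>If \<open>p\<close> or \<open>q\<close> belongs to \<open>{c..d}\<close>, it is
    within reach of \<open>x\<close>; so \<open>maximal N f\<close> is below \<open>A\<close> there,
    and \<open>dom\<close> bounds \<open>|f|\<close> at that point.\<close>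
  have "\<bar>f z\<bar> \<le> A" if "z \<in> {c..d}" for z
  proof -
    have "p \<le> z" "z \<le> q" using that by (auto simp: c_def d_def)
    then consider "p < z" "z < q" | "z = p" | "z = q" by linarith
    then show ?thesis
    proof cases
      case 2
      then have "maximal N f p < A" using that ab p by (auto simp: c_def)
      with 2 dom[of p] show ?thesis by simp
    next
      case 3
      then have "maximal N f q < A" using that ab q by (auto simp: d_def)
      with 3 dom[of q] show ?thesis by simp
    qed (use less in force)
  qed
  then have "integral {c..d} (\<lambda>s. \<bar>f s\<bar>) \<le> integral {c..d} (\<lambda>_. A)"
    by (intro integral_le int) auto
  then have mid: "integral {c..d} (\<lambda>s. \<bar>f s\<bar>) \<le> A * (d - c)"
    using ord by (simp add: mult.commute)
  have left: "integral {a..c} (\<lambda>s. \<bar>f s\<bar>) \<le> A * (c - a)"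
  proof (cases "a < p")
    case True
    then have "maximal N f p < A" using ab p by auto
    \<comment> \<open>Passing from \<open>x\<close> to \<open>p\<close> lowers the admissible length
      \<open>2 * N\<close> by at most \<open>x - p\<close>, which is what the piece
      \<open>{a..p}\<close> is shorter than \<open>{a..x}\<close>.\<close>
    moreover have "p - a \<le> 2 * N p" using N(2)[of x p] ab p(1) by (auto simp: abs_if split: if_splits)
    ultimately have "integral {a..p} (\<lambda>s. \<bar>f s\<bar>) \<le> A * (p - a)"
      using maximal_ge[OF BV True, of p N] True
      by (intro order_trans[OF _ mult_right_mono[of "maximal N f p" A]]) auto
    with True show ?thesis by (simp add: c_def)
  qed (simp add: c_def)
  have right: "integral {d..b} (\<lambda>s. \<bar>f s\<bar>) \<le> A * (b - d)"
  proof (cases "q < b")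
    case True
    then have "maximal N f q < A" using ab q by auto
    moreover have "b - q \<le> 2 * N q" using N(2)[of x q] ab q(1) by (auto simp: abs_if split: if_splits)
    ultimately have "integral {q..b} (\<lambda>s. \<bar>f s\<bar>) \<le> A * (b - q)"
      using maximal_ge[OF BV True, of q N] True
      by (intro order_trans[OF _ mult_right_mono[of "maximal N f q" A]]) auto
    with True show ?thesis by (simp add: d_def)
  qed (simp add: d_def)
  have "integral {a..b} (\<lambda>s. \<bar>f s\<bar>) =
      integral {a..c} (\<lambda>s. \<bar>f s\<bar>) + (integral {c..d} (\<lambda>s. \<bar>f s\<bar>) + integral {d..b} (\<lambda>s. \<bar>f s\<bar>))"
    using ord by (simp add: Henstock_Kurzweil_Integration.integral_combine int)
  also have "\<dots> \<le> A * (c - a) + (A * (d - c) + A * (b - d))"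
    using left mid right by linarith
  also have "\<dots> = A * (b - a)" by (simp add: algebra_simps)
  finally show False using avg by simp
qed

section \<open>Comparing variations through alternating extrema\<close>

text \<open>The flag \<open>up\<close> tells whether the first step rises. Every inner entry is then
  a strict local extremum of \<open>F\<close> along the list.\<close>

fun alternating :: "(real \<Rightarrow> real) \<Rightarrow> bool \<Rightarrow> real list \<Rightarrow> bool" where
  "alternating F up (x # y # xs) \<longleftrightarrow>
    x < y \<and> (if up then F x < F y else F y < F x) \<and> alternating F (\<not> up) (y # xs)"
| "alternating F up _ \<longleftrightarrow> True"

lemma alternating_list:
  assumes "sorted_wrt (<) (x # xs)"
  shows "\<exists>ys up. alternating F up (x # ys) \<and> list_variation F (x # ys) = list_variation F (x # xs)"
  using assms
proof (induction xs arbitrary: x)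
  case Nil
  show ?case by (intro exI[of _ "[]"]) auto
next
  case (Cons y xs)
  then have xy: "x < y" and "sorted_wrt (<) (y # xs)" by auto
  then obtain ys up where ys: "alternating F up (y # ys)"
    "list_variation F (y # ys) = list_variation F (y # xs)"
    using Cons.IH by blast
  consider "F x = F y" | "F x \<noteq> F y" "ys = []" | z zs where "F x \<noteq> F y" "ys = z # zs"
    by (cases ys) auto
  then show ?case
  proof cases
    case 1
    then have "alternating F up (x # ys)" "list_variation F (x # ys) = list_variation F (x # y # xs)"
      using ys xy by (cases ys; auto)+
    then show ?thesis by blast
  next
    case 2
    then have "alternating F (F x < F y) (x # y # ys)"
      "list_variation F (x # y # ys) = list_variation F (x # y # xs)"
      using ys xy by auto
    then show ?thesis by blast
  next
    case 3
    show ?thesis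
    proof (cases "up \<longleftrightarrow> F x < F y")
      case True
      \<comment> \<open>\<open>F y\<close> lies between the values at \<open>x\<close> and
        \<open>z\<close>, so \<open>y\<close> is dropped; in the other case \<open>y\<close> is a
        turning point and stays.\<close>
      then have "alternating F up (x # ys)" "list_variation F (x # ys) = list_variation F (x # y # xs)"
        using ys xy 3 by (auto split: if_splits)
      then show ?thesis by blast
    next
      case False
      then have "alternating F (\<not> up) (x # y # ys)"
        "list_variation F (x # y # ys) = list_variation F (x # y # xs)"
        using ys xy 3 by auto
      then show ?thesis by blast
    qed
  qed
qed

text \<open>
  The bounds L and R take the place of a missing neighbour at the two ends of a list, so that
  every local maximum of the list falls under the same hypothesis.
\<close>

lemma interleaved_list:
  assumes dom: "\<And>x. h x \<le> F x" and R: "\<And>x. x < R x"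
    and peak: "\<And>p x q. p < x \<Longrightarrow> x < q \<Longrightarrow> F p < F x \<or> p \<le> L x \<Longrightarrow> F q < F x \<or> R x \<le> q
      \<Longrightarrow> \<exists>z. p < z \<and> z < q \<and> F x - e \<le> h z"
    and "0 < e"
  shows "(alternating F True (x # ys) \<longrightarrow>
      (\<exists>zs. sorted_wrt (<) (x # zs) \<and>
        list_variation F (x # ys) \<le> list_variation h (x # zs) + e * length ys)) \<and>
    (alternating F False (x # ys) \<longrightarrow> (\<forall>p<x. F p < F x \<or> p \<le> L x \<longrightarrow>
      (\<exists>z zs. p < z \<and> F x - e \<le> h z \<and> sorted_wrt (<) (z # zs) \<and>
        list_variation F (x # ys) \<le> list_variation h (z # zs) + e * length ys)))"
\<comment> \<open>A head that is a minimum is kept; a head that is a maximum is replaced by a point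
  to the right of any given lower or remote \<open>p\<close>. The case of a minimum uses the latter
  claim for the tail, with \<open>p\<close> its own head. Each step of the list costs at most
  \<open>e\<close>.\<close>
proof (induction ys arbitrary: x)
  case Nil
  show ?case
  proof (intro conjI impI allI)
    show "\<exists>zs. sorted_wrt (<) (x # zs) \<and>
        list_variation F [x] \<le> list_variation h (x # zs) + e * length []"
      by (intro exI[of _ "[]"]) auto
    fix p assume "p < x" "F p < F x \<or> p \<le> L x"
    then obtain z where "p < z" "F x - e \<le> h z"
      using peak[of p x "R x"] R by auto
    then show "\<exists>z zs. p < z \<and> F x - e \<le> h z \<and> sorted_wrt (<) (z # zs) \<and>
        list_variation F [x] \<le> list_variation h (z # zs) + e * length []"
      by (intro exI[of _ z] exI[of _ "[]"]) auto
  qed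
next
  case (Cons y ys)
  show ?case
  proof (intro conjI impI allI)
    assume "alternating F True (x # y # ys)"
    then have xy: "x < y" "F x < F y" and "alternating F False (y # ys)" by auto
    with Cons.IH[of y] obtain z zs where z: "x < z" "F y - e \<le> h z" "sorted_wrt (<) (z # zs)"
      and le: "list_variation F (y # ys) \<le> list_variation h (z # zs) + e * length ys"
      by blast
    have "sorted_wrt (<) (x # z # zs)" using z by auto
    \<comment> \<open>Lowering the minimum from \<open>F x\<close> to \<open>h x\<close> only
      enlarges the rise; replacing \<open>F y\<close> by \<open>h z\<close> loses at most
      \<open>e\<close>.\<close>
    moreover have "list_variation F (x # y # ys) \<le>
        list_variation h (x # z # zs) + e * length (y # ys)"
      using le z(2) xy dom[of x] by (simp add: algebra_simps)
    ultimately show "\<exists>zs. sorted_wrt (<) (x # zs) \<and>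
        list_variation F (x # y # ys) \<le> list_variation h (x # zs) + e * length (y # ys)"
      by blast
  next
    fix p assume p: "p < x" "F p < F x \<or> p \<le> L x"
    assume "alternating F False (x # y # ys)"
    then have xy: "x < y" "F y < F x" and "alternating F True (y # ys)" by auto
    with Cons.IH[of y] obtain zs where zs: "sorted_wrt (<) (y # zs)"
      and le: "list_variation F (y # ys) \<le> list_variation h (y # zs) + e * length ys"
      by blast
    obtain z where z: "p < z" "z < y" "F x - e \<le> h z"
      using peak[OF p(1) xy(1) p(2)] xy(2) by blast
    have "sorted_wrt (<) (z # y # zs)" using z zs by auto
    moreover have "list_variation F (x # y # ys) \<le>
        list_variation h (z # y # zs) + e * length (y # ys)"
      using le z(3) xy dom[of y] by (simp add: algebra_simps)
    ultimately show "\<exists>z zs. p < z \<and> F x - e \<le> h z \<and> sorted_wrt (<) (z # zs) \<and>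
        list_variation F (x # y # ys) \<le> list_variation h (z # zs) + e * length (y # ys)"
      using z by blast
  qed
qed

text \<open>Only domination and the peak property enter the comparison. Thinning a list to its
  turning points and replacing the maxima gives the bound up to an arbitrarily small error.\<close>

lemma total_variation_le_of_peaks:
  assumes dom: "\<And>x. h x \<le> F x" and LR: "\<And>x. L x < x" "\<And>x. x < R x"
    and peak: "\<And>p x q A. A < F x \<Longrightarrow> p < x \<Longrightarrow> x < q \<Longrightarrow> F p < A \<or> p \<le> L x \<Longrightarrow> F q < A \<or> R x \<le> q
      \<Longrightarrow> \<exists>z. p < z \<and> z < q \<and> A \<le> h z"
  shows "total_variation F \<le> total_variation h"
proof (rule total_variation_leI)
  fix xs :: "real list"
  assume xs: "sorted_wrt (<) xs"
  show "ereal (list_variation F xs) \<le> total_variation h"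
  proof (cases xs)
    case Nil
    then show ?thesis using list_variation_le_total_variation[of "[]" h] by simp
  next
    case (Cons x xs')
    then obtain ys up where alt: "alternating F up (x # ys)"
      and ys: "list_variation F (x # ys) = list_variation F xs"
      using alternating_list[of x xs' F] xs by blast
    show ?thesis
    proof (rule ereal_le_epsilon2)
      fix \<epsilon> :: real assume "0 < \<epsilon>"
      \<comment> \<open>The error \<open>e\<close> per step adds up to at most
        \<open>\<epsilon>\<close>; the summand 1 covers empty \<open>ys\<close>.\<close>
      define e where "e = \<epsilon> / (length ys + 1)"
      have e: "0 < e" "e * length ys \<le> \<epsilon>"
        using \<open>0 < \<epsilon>\<close> by (auto simp: e_def field_simps)
      have peak': "\<exists>z. p < z \<and> z < q \<and> F x - e \<le> h z"
        if pq: "p < x" "x < q" "F p < F x \<or> p \<le> L x" "F q < F x \<or> R x \<le> q" for p x q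
      proof -
        obtain A where "F x - e \<le> A" "A < F x" "F p < A \<or> p \<le> L x" "F q < A \<or> R x \<le> q"
        proof -
          \<comment> \<open>The level \<open>A\<close> must stay below \<open>F x\<close> but exceed
            \<open>F x - e\<close> and every neighbouring value below \<open>F x\<close>. A
            neighbour not below \<open>F x\<close> contributes the default
            \<open>F x - e\<close>.\<close>
          define m where "m = max (F x - e) (max (if F p < F x then F p else F x - e)
            (if F q < F x then F q else F x - e))"
          have "m < F x" using e by (auto simp: m_def)
          then obtain A where A: "m < A" "A < F x" using dense by blast
          then have "F x - e < A" "F p < F x \<Longrightarrow> F p < A" "F q < F x \<Longrightarrow> F q < A"
            by (auto simp: m_def)
          with A pq show thesis by (intro that[of A]) auto
        qed
        then show ?thesis using peak[of A x p q] pq(1,2) by (meson order_trans)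
      qed
      obtain zs where "sorted_wrt (<) zs"
        "list_variation F (x # ys) \<le> list_variation h zs + e * length ys"
      proof (cases up)
        case True
        have "\<exists>zs. sorted_wrt (<) (x # zs) \<and>
            list_variation F (x # ys) \<le> list_variation h (x # zs) + e * length ys"
          by (rule interleaved_list[where L=L and R=R, THEN conjunct1, THEN mp])
            ((rule dom LR(2) e(1) | erule (3) peak')+, use alt True in simp)
        then show thesis using that by blast
      next
        case False
        have "\<forall>p<x. F p < F x \<or> p \<le> L x \<longrightarrow>
          (\<exists>z zs. p < z \<and> F x - e \<le> h z \<and> sorted_wrt (<) (z # zs) \<and>
            list_variation F (x # ys) \<le> list_variation h (z # zs) + e * length ys)"
          by (rule interleaved_list[where L=L and R=R, THEN conjunct2, THEN mp])
            ((rule dom LR(2) e(1) | erule (3) peak')+, use alt False in simp)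
        then have "\<exists>z zs. L x < z \<and> F x - e \<le> h z \<and> sorted_wrt (<) (z # zs) \<and>
            list_variation F (x # ys) \<le> list_variation h (z # zs) + e * length ys"
          using LR(1)[of x] by blast
        then show thesis using that by blast
      qed
      then have "ereal (list_variation F xs) \<le> ereal (list_variation h zs) + ereal \<epsilon>"
        using ys e by simp
      also have "\<dots> \<le> total_variation h + ereal \<epsilon>"
        using list_variation_le_total_variation[OF \<open>sorted_wrt (<) zs\<close>] by (rule add_right_mono)
      finally show "ereal (list_variation F xs) \<le> total_variation h + ereal \<epsilon>" .
    qed
  qed
qed

section \<open>The variation bound for the maximal function\<close>

lemma total_variation_maximal_le:
  assumes "f \<in> BV" "normalized f" "\<And>x. 0 < N x" "\<And>x y. \<bar>N x - N y\<bar> \<le> \<bar>x - y\<bar> / 2"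
  shows "total_variation (maximal N f) \<le> total_variation f"
proof -
  have dom: "\<bar>f x\<bar> \<le> maximal N f x" for x
    using assms by (intro abs_le_maximal) auto
  have "total_variation (maximal N f) \<le> total_variation (\<lambda>x. \<bar>f x\<bar>)"
  \<comment> \<open>The extra 1 turns the non-strict bounds on remote neighbours into the strict
    ones of \<open>maximal_peak\<close>.\<close>
  proof (rule total_variation_le_of_peaks[where L="\<lambda>x. x - 2 * N x - 1" and R="\<lambda>x. x + 2 * N x + 1"])
    show "x - 2 * N x - 1 < x" "x < x + 2 * N x + 1" for x
      using assms(3)[of x] by simp_all
    fix p x q A
    assume "A < maximal N f x" "p < x" "x < q"
      "maximal N f p < A \<or> p \<le> x - 2 * N x - 1" "maximal N f q < A \<or> x + 2 * N x + 1 \<le> q"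
    then show "\<exists>z. p < z \<and> z < q \<and> A \<le> \<bar>f z\<bar>"
      by (intro maximal_peak[of f N A x p q, OF assms(1) assms(3,4) dom]) auto
  qed (rule dom)
  also have "\<dots> \<le> total_variation f" by (rule total_variation_abs_le)
  finally show ?thesis .
qed

lemma abs_diff_le_of_Lip:
  assumes "Lip N \<le> ereal c"
  shows "\<bar>N x - N y\<bar> \<le> c * \<bar>x - y\<bar>"
proof (cases "x = y")
  case False
  then have "(x, y) \<in> {(x, y). x \<noteq> y}" by simp
  from SUP_upper[OF this, of "\<lambda>(x, y). ereal (\<bar>N x - N y\<bar> / \<bar>x - y\<bar>)"]
  have "ereal (\<bar>N x - N y\<bar> / \<bar>x - y\<bar>) \<le> Lip N"
    by (simp add: Lip_def)
  also note assms
  finally show ?thesis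
    using False by (simp add: field_simps)
qed simp

section \<open>Sharpness\<close>

lemma step_function:
  fixes c :: real
  defines "f \<equiv> indicat_real {c..}"
  shows "f \<in> BV" "normalized f" "\<not> f constant_on UNIV" "total_variation f \<le> 1"
proof -
  have tv: "total_variation f \<le> ereal (1 - 0)"
    by (rule total_variation_mono) (auto simp: f_def indicator_def intro!: monoI)
  then show "total_variation f \<le> 1" by (simp add: one_ereal_def)
  have version: "BV_version f f"
    using tv by (auto simp: BV_version_def intro: le_less_trans)
  then show "f \<in> BV" by (auto simp: BV_def)
  \<comment> \<open>The limit superior at the jump is the upper value 1, which is why the half-line
    \<open>{c..}\<close> is closed. The left limits are those of the open half-line.\<close>
  have "ereal (f x) = Limsup (at x) (\<lambda>y. ereal (f y))" for x
  proof -
    have "\<forall>\<^sub>F y in at_left x. f y = indicat_real {c<..} x"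
      unfolding eventually_at_left_field f_def
      by (rule exI[of _ "if c < x then c else x - 1"]) (auto simp: indicator_def)
    then have l: "(f \<longlongrightarrow> indicat_real {c<..} x) (at_left x)"
      by (rule tendsto_eventually)
    have "\<forall>\<^sub>F y in at_right x. f y = f x"
      unfolding eventually_at_right_field f_def
      by (rule exI[of _ "if x < c then c else x + 1"]) (auto simp: indicator_def)
    then have r: "(f \<longlongrightarrow> f x) (at_right x)"
      by (rule tendsto_eventually)
    show ?thesis
      unfolding Limsup_at_eq_max_one_sided[OF l r] by (auto simp: f_def indicator_def)
  qed
  with version show "normalized f" unfolding normalized_def by blast
  have "f c \<noteq> f (c - 1)" by (simp add: f_def)
  then show "\<not> f constant_on UNIV" by (metis UNIV_I constant_on_def)
qed

theorem theorem3:
  fixes N :: "real \<Rightarrow> real"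
  assumes "\<And>x. 0 < N x"
    and "N \<in> borel_measurable lebesgue"
    and "Lip N \<le> ereal (1 / 2)"
  shows "(\<forall>f\<in>BV. normalized f \<longrightarrow> total_variation (maximal N f) \<le> total_variation f) \<and>
         (\<exists>f\<in>BV. normalized f \<and> \<not> f constant_on UNIV \<and>
            total_variation f = total_variation (maximal N f))"
proof -
  have N: "\<bar>N x - N y\<bar> \<le> \<bar>x - y\<bar> / 2" for x y
    using abs_diff_le_of_Lip[OF assms(3), of x y] by simp
  have le: "total_variation (maximal N f) \<le> total_variation f" if "f \<in> BV" "normalized f" for f
    using total_variation_maximal_le[of f N] that assms(1) N by blast
  \<comment> \<open>A step so far to the right that no interval admissible at 0 reaches it.\<close>
  define c where "c = 2 * N 0 + 1"
  define f where "f = indicat_real {c..}"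
  note f = step_function[of c, folded f_def]
  \<comment> \<open>With the value at \<open>c\<close> at least 1, this yields variation at least 1
    for \<open>maximal N f\<close>, while that of \<open>f\<close> is at most 1.\<close>
  have "maximal N f 0 \<le> 0"
  proof (rule ccontr)
    assume "\<not> maximal N f 0 \<le> 0"
    then have "0 < maximal N f 0" by simp
    from less_maximal[OF f(1) assms(1) this]
    obtain a b where "a \<le> 0" "0 \<le> b" "b - a \<le> 2 * N 0" "0 * (b - a) < integral {a..b} (\<lambda>s. \<bar>f s\<bar>)" .
    moreover from this have "integral {a..b} (\<lambda>s. \<bar>f s\<bar>) = integral {a..b} (\<lambda>_. 0)"
      by (intro integral_cong) (auto simp: f_def c_def indicator_def)
    ultimately show False by simp
  qed
  moreover have "1 \<le> maximal N f c"
    using abs_le_maximal[where N=N and x=c, OF f(1,2) assms(1)] by (simp add: f_def)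
  ultimately have "1 \<le> ereal \<bar>maximal N f c - maximal N f 0\<bar>" by (simp add: one_ereal_def)
  also have "\<dots> \<le> total_variation (maximal N f)" by (rule total_variation_ge_abs_diff)
  finally have "total_variation f \<le> total_variation (maximal N f)"
    using f(4) by (rule order_trans[rotated])
  with le[OF f(1,2)] have "total_variation f = total_variation (maximal N f)" by simp
  with le f show ?thesis by blast
qed

end
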